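(* For integers $p,m>1$ and $q>0$, \begin{align*} \sum_{n=1}^\infty\frac{\zeta(m)\zeta_n(p)\zeta_n(q)-\zeta(p)\zeta_n(m)\zeta_n(q)}{n} ={}&\zeta(p)\Big\{\sum_{n=1}^\infty\Big(\frac{H_n\zeta_n(m)}{n^q}+\frac{H_n\zeta_n(q)}{n^m}\Big)-\zeta^\star(q+1,m)-\zeta^\star(m+q,1)-\zeta^\star(m+1,q)\Big\}\\ &-\zeta(m)\Big\{\sum_{n=1}^\infty\Big(\frac{H_n\zeta_n(q)}{n^p}+\frac{H_n\zeta_n(p)}{n^q}\Big)-\zeta^\star(q+1,p)-\zeta^\star(p+q,1)-\zeta^\star(p+1,q)\Big\}\\ &+\zeta(m+q+1)\zeta(p)-\zeta(p+q+1)\zeta(m). \end{align*}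
   Context: $\zeta(s)=\sum_{j\ge1}j^{-s}$, $\zeta_n(s)=\sum_{j=1}^n j^{-s}$, $H_n=\zeta_n(1)$; multiple zeta star value $\zeta^\star(s_1,\dots,s_k)=\sum_{n_1\ge\cdots\ge n_k\ge1}n_1^{-s_1}\cdots n_k^{-s_k}$.
   Formalization: For q=1 the two series on the right diverge separately, so the formula is proved as printed for q>1; for all q>0, including q=1, it is proved with ζ(p) times the first series minus ζ(m) times the second taken as one termwise series. *)

theory Defs
  imports "HOL-Analysis.Analysis"
begin

definition zeta_val :: "nat \<Rightarrow> real" where
  "zeta_val s = (\<Sum>j. 1 / real (Suc j) ^ s)"

definition zeta_n :: "nat \<Rightarrow> nat \<Rightarrow> real" where
  "zeta_n n s = (\<Sum>j=1..n. 1 / real j ^ s)"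

text \<open>The harmonic numbers are the library's \<^const>\<open>harm\<close>.\<close>

lemma harm_eq_zeta_n: "harm n = zeta_n n 1"
  by (simp add: harm_def zeta_n_def field_simps)

text \<open>
  The summation runs over all weakly decreasing lists of positive integers. All terms are
  nonnegative, so the unordered sum agrees with any ordered reading; it is 0 if the sum diverges,
  but a list of positive exponents whose first entry is at least 2 gives a convergent sum.
\<close>

definition zeta_star :: "nat list \<Rightarrow> real" where
  "zeta_star ss =
     (\<Sum>\<^sub>\<infinity>ns\<in>{ns. length ns = length ss \<and> sorted_wrt (\<ge>) ns \<and> (\<forall>n\<in>set ns. 1 \<le> n)}.
        \<Prod>i<length ss. 1 / real (ns ! i) ^ (ss ! i))"

end

theory Submission
  imports Defs
begin

text \<open>
  Summation by parts for the product \<open>H\<^sub>n \<zeta>\<^sub>n(r) \<zeta>\<^sub>n(q)\<close> of three partial sums gives, for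
  every \<open>N\<close>, an identity between \<open>H\<^sub>N \<zeta>\<^sub>N(r) \<zeta>\<^sub>N(q)\<close> and the partial sums of all the series
  in the theorem. Take \<open>\<zeta>(m)\<close> times the identity for \<open>r = p\<close> minus \<open>\<zeta>(p)\<close> times the one for
  \<open>r = m\<close>: the boundary term is \<open>H\<^sub>N \<zeta>\<^sub>N(q) (\<zeta>(m) \<zeta>\<^sub>N(p) - \<zeta>(p) \<zeta>\<^sub>N(m))\<close>, where the last factor is
  \<open>O(1/N)\<close>, so it vanishes in the limit.
\<close>

section \<open>Partial sums of the zeta series and the size of their tails\<close>

lemma zeta_n_0 [simp]: "zeta_n 0 s = 0"
  by (simp add: zeta_n_def)

lemma zeta_n_Suc: "zeta_n (Suc n) s = zeta_n n s + 1 / real (Suc n) ^ s"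
  by (simp add: zeta_n_def)

lemma zeta_n_altdef: "zeta_n n s = (\<Sum>j<n. 1 / real (Suc j) ^ s)"
  by (induction n) (simp_all add: zeta_n_Suc)

lemma zeta_n_nonneg [simp]: "zeta_n n s \<ge> 0"
  by (simp add: zeta_n_def sum_nonneg)

lemma zeta_n_le_harm: "s \<ge> 1 \<Longrightarrow> zeta_n n s \<le> harm n"
  unfolding harm_eq_zeta_n zeta_n_def
  by (intro sum_mono divide_left_mono power_increasing) auto

lemma zeta_val_sums:
  assumes "s > 1"
  shows "(\<lambda>j. 1 / real (Suc j) ^ s) sums zeta_val s"
proof -
  have "summable (\<lambda>j. inverse (real j ^ s))"
    using assms by (intro inverse_power_summable) auto
  hence "summable (\<lambda>j. 1 / real (Suc j) ^ s)"
    by (subst (asm) summable_Suc_iff [symmetric]) (simp add: field_simps)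
  thus ?thesis
    unfolding zeta_val_def by (rule summable_sums)
qed

lemma zeta_n_tendsto: "s > 1 \<Longrightarrow> (\<lambda>n. zeta_n n s) \<longlonglongrightarrow> zeta_val s"
  using zeta_val_sums [of s] by (simp add: sums_def zeta_n_altdef)

lemma zeta_n_le_zeta_val:
  assumes "s > 1"
  shows "zeta_n n s \<le> zeta_val s"
proof -
  have "incseq (\<lambda>n. zeta_n n s)"
    by (intro incseq_SucI) (simp add: zeta_n_Suc)
  thus ?thesis
    using zeta_n_tendsto [OF assms] by (rule incseq_le)
qed

lemma zeta_val_nonneg: "s > 1 \<Longrightarrow> zeta_val s \<ge> 0"
  using zeta_n_le_zeta_val [of s 0] by simp

text \<open>Since s >= 2, each term 1/(k+1)^s is at most 1/(k(k+1)), which telescopes to 1/n when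
  summed over k >= n.\<close>

lemma zeta_val_tail_le:
  assumes "s > 1" and "n > 0"
  shows "zeta_val s - zeta_n n s \<le> 1 / real n"
proof -
  have telescope: "1 / real (Suc k) ^ s \<le> 1 / real k - 1 / real (Suc k)" if "k > 0" for k
  proof -
    have "1 / real (Suc k) ^ s \<le> 1 / real (Suc k) ^ 2"
      using assms by (intro divide_left_mono power_increasing) auto
    also have "\<dots> \<le> 1 / (real k * real (Suc k))"
      using that by (intro divide_left_mono) (auto simp: power2_eq_square)
    also have "\<dots> = 1 / real k - 1 / real (Suc k)"
      using that by (simp add: field_simps)
    finally show ?thesis .
  qed
  have "zeta_n k s \<le> zeta_n n s + 1 / real n - 1 / real k" if "k \<ge> n" for k
    using that
  proof (induction k rule: dec_induct)
    case (step k)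
    then show ?case
      using \<open>n > 0\<close> step telescope [of k] by (simp add: zeta_n_Suc)
  qed simp
  hence "zeta_n k s \<le> zeta_n n s + 1 / real n" if "k \<ge> n" for k
    using that by (smt (verit) of_nat_0_le_iff divide_nonneg_nonneg)
  hence "zeta_val s \<le> zeta_n n s + 1 / real n"
    by (intro LIMSEQ_le_const2 [OF zeta_n_tendsto [OF assms(1)]]) blast
  thus ?thesis by simp
qed

text \<open>The products \<open>zeta_val m * zeta_val p\<close> cancel, so only the two tails
  remain, each at most 1/n. This decay drives both the convergence of the left-hand series and the
  vanishing of the boundary term.\<close>

lemma abs_zeta_cross_le:
  assumes "p > 1" and "m > 1" and "n > 0"
  shows "\<bar>zeta_val m * zeta_n n p - zeta_val p * zeta_n n m\<bar> \<le> (zeta_val m + zeta_val p) / real n"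
proof -
  define x where "x = zeta_val m - zeta_n n m"
  define y where "y = zeta_val p - zeta_n n p"
  have x: "0 \<le> x" "x \<le> 1 / real n" and y: "0 \<le> y" "y \<le> 1 / real n"
    using assms by (simp_all add: x_def y_def zeta_n_le_zeta_val zeta_val_tail_le)
  have "zeta_val m * zeta_n n p - zeta_val p * zeta_n n m = zeta_val p * x - zeta_val m * y"
    by (simp add: x_def y_def algebra_simps)
  also have "\<bar>\<dots>\<bar> \<le> zeta_val p * x + zeta_val m * y"
    using x y assms by (simp add: zeta_val_nonneg abs_le_iff add_nonneg_nonneg mult_nonneg_nonneg)
  also have "\<dots> \<le> zeta_val p * (1 / real n) + zeta_val m * (1 / real n)"
    using x y assms by (intro add_mono mult_left_mono) (simp_all add: zeta_val_nonneg)
  finally show ?thesis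
    by (simp add: add_divide_distrib add.commute)
qed

section \<open>Growth of the harmonic numbers and convergence of the single series\<close>

lemma harm_le_root: "harm n \<le> 4 * real n powr (1/4)"
proof (cases n)
  case (Suc k)
  have "harm (Suc k) - ln (real (Suc k)) \<le> harm (Suc 0) - ln (real (Suc 0))"
    using decseqD [OF decseq_harm_diff_ln, of 0 k] by simp
  hence "harm n \<le> 1 + ln (real n)"
    by (simp add: Suc harm_expand)
  \<comment> \<open>The logarithm is traded for a small power. With exponent 1/4, a product of two
    harmonic factors costs only n^(1/2), still less than the decay 1/n of the cross
    difference.\<close>
  also have "ln (real n) = 4 * ln (real n powr (1/4))"
    by (simp add: Suc ln_powr)
  also have "\<dots> \<le> 4 * (real n powr (1/4) - 1)"
    by (intro mult_left_mono ln_le_minus_one) (auto simp: Suc)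
  finally show ?thesis by simp
qed (simp add: harm_expand)

lemma summable_harm_over_square: "summable (\<lambda>n. harm (Suc n) / real (Suc n) ^ 2)"
proof -
  have "summable (\<lambda>n. real n powr (- 7/4))"
    by (subst summable_real_powr_iff) simp
  hence "summable (\<lambda>n. 4 * real (Suc n) powr (- 7/4))"
    by (intro summable_mult) (subst summable_Suc_iff)
  moreover have "norm (harm (Suc n) / real (Suc n) ^ 2) \<le> 4 * real (Suc n) powr (- 7/4)" for n
  proof -
    have "harm (Suc n) / real (Suc n) ^ 2 \<le> 4 * real (Suc n) powr (1/4) / real (Suc n) ^ 2"
      by (intro divide_right_mono harm_le_root) auto
    also have "\<dots> = 4 * (real (Suc n) powr (1/4) / real (Suc n) powr 2)"
      by simp
    also have "\<dots> = 4 * real (Suc n) powr (- 7/4)"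
      by (subst powr_diff [symmetric]) simp
    finally show ?thesis by (simp add: harm_nonneg)
  qed
  ultimately show ?thesis
    by (rule summable_comparison_test')
qed

lemma summable_bounded_by_harm:
  fixes f :: "nat \<Rightarrow> real"
  assumes "\<And>n. \<bar>f n\<bar> \<le> C * harm (Suc n) / real (Suc n) ^ 2"
  shows "summable f"
proof (rule summable_comparison_test')
  show "summable (\<lambda>n. C * (harm (Suc n) / real (Suc n) ^ 2))"
    by (intro summable_mult summable_harm_over_square)
  show "norm (f n) \<le> C * (harm (Suc n) / real (Suc n) ^ 2)" for n
    using assms [of n] by simp
qed

lemma summable_zeta_n_over_power:
  assumes "s > 1" and "t > 0"
  shows "summable (\<lambda>n. zeta_n (Suc n) t / real (Suc n) ^ s)"
proof (rule summable_bounded_by_harm)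
  fix n
  show "\<bar>zeta_n (Suc n) t / real (Suc n) ^ s\<bar> \<le> 1 * harm (Suc n) / real (Suc n) ^ 2"
    using assms by (simp del: of_nat_Suc power_Suc)
      (intro frac_le zeta_n_le_harm power_increasing; simp add: harm_nonneg)
qed

text \<open>With a > 1 the factor \<open>zeta_n\<close> is bounded by its limit, leaving a single
  harmonic factor over at least a square. Both series on the right need this for exponent q as well,
  hence the case q > 1 in the theorem.\<close>

lemma summable_harm_zeta_n_over_power:
  assumes "a > 1" and "b > 1"
  shows "summable (\<lambda>n. harm (Suc n) * zeta_n (Suc n) a / real (Suc n) ^ b)"
proof (rule summable_bounded_by_harm)
  fix n
  have "harm (Suc n) * zeta_n (Suc n) a / real (Suc n) ^ b
          \<le> harm (Suc n) * zeta_val a / real (Suc n) ^ 2"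
    using assms by (intro frac_le mult_left_mono zeta_n_le_zeta_val power_increasing)
      (simp_all add: harm_nonneg zeta_val_nonneg)
  thus "\<bar>harm (Suc n) * zeta_n (Suc n) a / real (Suc n) ^ b\<bar>
          \<le> zeta_val a * harm (Suc n) / real (Suc n) ^ 2"
    by (simp add: harm_nonneg mult.commute)
qed

section \<open>Double star values as series of finite inner sums\<close>

lemma zeta_star_pair_sums:
  assumes "s > 1" and "t > 0"
  shows "(\<lambda>n. zeta_n (Suc n) t / real (Suc n) ^ s) sums zeta_star [s, t]"
proof -
  let ?g = "\<lambda>n. zeta_n (Suc n) t / real (Suc n) ^ s"
  \<comment> \<open>Pairs are grouped by the larger entry. It is stored as its predecessor n to
    match the shifted series, while k is the smaller entry itself.\<close>
  let ?f = "\<lambda>(n, k). 1 / real (Suc n) ^ s * (1 / real k ^ t)"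
  let ?h = "\<lambda>(n, k). [Suc n, k]"
  let ?D = "SIGMA n:UNIV. {1..Suc n}"
  let ?L = "{ns. length ns = length [s, t] \<and> sorted_wrt (\<ge>) ns \<and> (\<forall>n\<in>set ns. 1 \<le> n)}"
  have sums: "?g sums suminf ?g"
    using summable_zeta_n_over_power [OF assms] by (rule summable_sums)
  have has_sum: "(?g has_sum suminf ?g) UNIV"
    by (rule sums_nonneg_imp_has_sum [OF sums]) simp
  have inner: "((\<lambda>k. ?f (n, k)) has_sum ?g n) {1..Suc n}" for n
    by (rule has_sum_finiteI) (simp_all add: zeta_n_def sum_divide_distrib mult.commute del: sum.cl_ivl_Suc)
  have "(?f has_sum suminf ?g) ?D"
  proof (rule has_sum_SigmaI [OF inner has_sum])
    \<comment> \<open>All terms are nonnegative, so convergence of the series of row sums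
      suffices.\<close>
    show "?f summable_on ?D"
      by (rule summable_on_SigmaI [OF inner has_sum_imp_summable [OF has_sum]]) simp
  qed
  also have "?f = (\<lambda>x. \<Prod>i<length [s, t]. 1 / real (?h x ! i) ^ ([s, t] ! i))"
    by (auto simp: fun_eq_iff)
  also have "(\<dots> has_sum suminf ?g) ?D \<longleftrightarrow>
      ((\<lambda>ns. \<Prod>i<length [s, t]. 1 / real (ns ! i) ^ ([s, t] ! i)) has_sum suminf ?g) ?L"
  proof (rule has_sum_reindex_bij_betw)
    show "bij_betw ?h ?D ?L"
      by (rule bij_betw_byWitness [where f' = "\<lambda>ns. (ns ! 0 - 1, ns ! 1)"])
         (auto simp: length_Suc_conv)
  qed
  finally have "zeta_star [s, t] = suminf ?g"
    unfolding zeta_star_def by (rule infsumI)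
  with sums show ?thesis by simp
qed

section \<open>Summation by parts and the boundary term\<close>

lemma harm_zeta_n_product_by_parts:
  "harm N * zeta_n N r * zeta_n N q =
     (\<Sum>n<N. zeta_n (Suc n) r * zeta_n (Suc n) q / real (Suc n)) +
     (\<Sum>n<N. harm (Suc n) * zeta_n (Suc n) r / real (Suc n) ^ q
            + harm (Suc n) * zeta_n (Suc n) q / real (Suc n) ^ r) -
     (\<Sum>n<N. zeta_n (Suc n) r / real (Suc n) ^ (q + 1)) -
     (\<Sum>n<N. zeta_n (Suc n) 1 / real (Suc n) ^ (r + q)) -
     (\<Sum>n<N. zeta_n (Suc n) q / real (Suc n) ^ (r + 1)) +
     zeta_n N (r + q + 1)"
proof (induction N)
  case (Suc N)
  \<comment> \<open>Let u, v, w be the new values of the three partial sums and a, b, c their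
    increments. Expanding (u-a)(v-b)(w-c) gives uvw - (u-a)(v-b)(w-c) = avw + buw + cuv - abw - acv
    - bcu + abc. These seven terms are the new summands on the right.\<close>
  define x where "x = real (Suc N)"
  define a where "a = 1 / x"
  define b where "b = 1 / x ^ r"
  define c where "c = 1 / x ^ q"
  have incr: "harm (Suc N) = harm N + a" "zeta_n (Suc N) r = zeta_n N r + b"
    "zeta_n (Suc N) q = zeta_n N q + c" "zeta_n (Suc N) 1 = harm N + a"
    "zeta_n (Suc N) (r + q + 1) = zeta_n N (r + q + 1) + a * b * c"
    by (simp_all add: zeta_n_Suc harm_eq_zeta_n a_def b_def c_def x_def power_add mult_ac)
  have div: "y / x = y * a" "y / x ^ r = y * b" "y / x ^ q = y * c"
    "y / x ^ (q + 1) = y * (a * c)" "y / x ^ (r + q) = y * (b * c)" "y / x ^ (r + 1) = y * (a * b)" for y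
    by (simp_all add: a_def b_def c_def power_add mult_ac)
  show ?case
    unfolding sum.lessThan_Suc x_def [symmetric] div incr using Suc.IH by (simp add: algebra_simps)
qed (simp add: harm_expand)

lemma boundary_tendsto_0:
  assumes "p > 1" and "m > 1" and "q > 0"
  shows "(\<lambda>N. harm N * zeta_n N q * (zeta_val m * zeta_n N p - zeta_val p * zeta_n N m)) \<longlonglongrightarrow> 0"
proof (rule Lim_null_comparison)
  define K where "K = zeta_val m + zeta_val p"
  have K: "K \<ge> 0"
    using assms by (simp add: K_def zeta_val_nonneg)
  show "\<forall>\<^sub>F N in sequentially.
      norm (harm N * zeta_n N q * (zeta_val m * zeta_n N p - zeta_val p * zeta_n N m))
        \<le> 16 * K * real N powr (- 1/2)"
    using eventually_gt_at_top [of 0]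
  proof eventually_elim
    case (elim N)
    have "norm (harm N * zeta_n N q * (zeta_val m * zeta_n N p - zeta_val p * zeta_n N m))
        = harm N * zeta_n N q * \<bar>zeta_val m * zeta_n N p - zeta_val p * zeta_n N m\<bar>"
      by (simp add: abs_mult)
    \<comment> \<open>The factor \<open>zeta_n N q\<close> is also compared with
      \<open>harm N\<close>, because q = 1 is allowed.\<close>
    also have "\<dots> \<le> (4 * real N powr (1/4)) * (4 * real N powr (1/4)) * (K / real N)"
      using K assms elim order.trans [OF zeta_n_le_harm harm_le_root]
        abs_zeta_cross_le [OF assms(1,2) elim]
      by (intro mult_mono harm_le_root) (auto simp: K_def)
    also have "\<dots> = 16 * K * (real N powr (1/4 + 1/4) / real N powr 1)"
      unfolding powr_add using elim by simp
    also have "\<dots> = 16 * K * real N powr (- 1/2)"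
      by (subst powr_diff [symmetric]) simp
    finally show ?case .
  qed
  have "(\<lambda>N. real N powr (- 1/2)) \<longlonglongrightarrow> 0"
    using tendsto_neg_powr [of "- 1/2" real sequentially] filterlim_real_sequentially by simp
  thus "(\<lambda>N. 16 * K * real N powr (- 1/2)) \<longlonglongrightarrow> 0"
    by (rule tendsto_mult_right_zero)
qed

text \<open>The cross difference supplies a second factor 1/n, and \<open>zeta_n\<close> at q costs
  at most one harmonic factor. Taken apart, the two halves of the numerator would give divergent
  series.\<close>

lemma summable_cross_product:
  assumes "p > 1" and "m > 1" and "q > 0"
  shows "summable (\<lambda>n. (zeta_val m * zeta_n (Suc n) p * zeta_n (Suc n) q
                     - zeta_val p * zeta_n (Suc n) m * zeta_n (Suc n) q) / real (Suc n))"
proof (rule summable_bounded_by_harm)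
  fix n
  let ?d = "zeta_val m * zeta_n (Suc n) p - zeta_val p * zeta_n (Suc n) m"
  have "\<bar>?d\<bar> * zeta_n (Suc n) q / real (Suc n)
      \<le> (zeta_val m + zeta_val p) / real (Suc n) * harm (Suc n) / real (Suc n)"
    using assms by (intro divide_right_mono mult_mono abs_zeta_cross_le zeta_n_le_harm)
      (auto simp: zeta_val_nonneg)
  thus "\<bar>(zeta_val m * zeta_n (Suc n) p * zeta_n (Suc n) q
           - zeta_val p * zeta_n (Suc n) m * zeta_n (Suc n) q) / real (Suc n)\<bar>
      \<le> (zeta_val m + zeta_val p) * harm (Suc n) / real (Suc n) ^ 2"
    by (simp add: left_diff_distrib [symmetric] abs_mult power2_eq_square del: of_nat_Suc)
qed

theorem theorem3p4:
  fixes p m q :: nat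
  assumes "p > 1" and "m > 1" and "q > 0"
  shows
    "summable (\<lambda>n. (zeta_val m * zeta_n (Suc n) p * zeta_n (Suc n) q
                     - zeta_val p * zeta_n (Suc n) m * zeta_n (Suc n) q) / real (Suc n)) \<and>
     (q > 1 \<longrightarrow>
       summable (\<lambda>n. harm (Suc n) * zeta_n (Suc n) m / real (Suc n) ^ q
                   + harm (Suc n) * zeta_n (Suc n) q / real (Suc n) ^ m) \<and>
       summable (\<lambda>n. harm (Suc n) * zeta_n (Suc n) q / real (Suc n) ^ p
                   + harm (Suc n) * zeta_n (Suc n) p / real (Suc n) ^ q) \<and>
       (\<Sum>n. (zeta_val m * zeta_n (Suc n) p * zeta_n (Suc n) q
               - zeta_val p * zeta_n (Suc n) m * zeta_n (Suc n) q) / real (Suc n))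
       = zeta_val p *
           ((\<Sum>n. harm (Suc n) * zeta_n (Suc n) m / real (Suc n) ^ q
                 + harm (Suc n) * zeta_n (Suc n) q / real (Suc n) ^ m)
            - zeta_star [q + 1, m] - zeta_star [m + q, 1] - zeta_star [m + 1, q])
         - zeta_val m *
           ((\<Sum>n. harm (Suc n) * zeta_n (Suc n) q / real (Suc n) ^ p
                 + harm (Suc n) * zeta_n (Suc n) p / real (Suc n) ^ q)
            - zeta_star [q + 1, p] - zeta_star [p + q, 1] - zeta_star [p + 1, q])
         + zeta_val (m + q + 1) * zeta_val p - zeta_val (p + q + 1) * zeta_val m) \<and>
     \<comment> \<open>For q = 1 the two series on the right diverge separately; the formula then holds
         with their weighted difference taken as a single series.\<close>
     summable (\<lambda>n.
         zeta_val p * (harm (Suc n) * zeta_n (Suc n) m / real (Suc n) ^ q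
                     + harm (Suc n) * zeta_n (Suc n) q / real (Suc n) ^ m)
       - zeta_val m * (harm (Suc n) * zeta_n (Suc n) q / real (Suc n) ^ p
                     + harm (Suc n) * zeta_n (Suc n) p / real (Suc n) ^ q)) \<and>
     (\<Sum>n. (zeta_val m * zeta_n (Suc n) p * zeta_n (Suc n) q
             - zeta_val p * zeta_n (Suc n) m * zeta_n (Suc n) q) / real (Suc n))
     = (\<Sum>n.
           zeta_val p * (harm (Suc n) * zeta_n (Suc n) m / real (Suc n) ^ q
                       + harm (Suc n) * zeta_n (Suc n) q / real (Suc n) ^ m)
         - zeta_val m * (harm (Suc n) * zeta_n (Suc n) q / real (Suc n) ^ p
                       + harm (Suc n) * zeta_n (Suc n) p / real (Suc n) ^ q))
       - zeta_val p * (zeta_star [q + 1, m] + zeta_star [m + q, 1] + zeta_star [m + 1, q])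
       + zeta_val m * (zeta_star [q + 1, p] + zeta_star [p + q, 1] + zeta_star [p + 1, q])
       + zeta_val (m + q + 1) * zeta_val p - zeta_val (p + q + 1) * zeta_val m"
proof (intro conjI impI)
  let ?U = "\<lambda>n. (zeta_val m * zeta_n (Suc n) p * zeta_n (Suc n) q
                  - zeta_val p * zeta_n (Suc n) m * zeta_n (Suc n) q) / real (Suc n)"
  let ?X = "\<lambda>r n. harm (Suc n) * zeta_n (Suc n) r / real (Suc n) ^ q
                  + harm (Suc n) * zeta_n (Suc n) q / real (Suc n) ^ r"
  \<comment> \<open>This is \<open>?X p\<close> with its summands swapped, as in the
    statement.\<close>
  let ?Y = "\<lambda>n. harm (Suc n) * zeta_n (Suc n) q / real (Suc n) ^ p
                  + harm (Suc n) * zeta_n (Suc n) p / real (Suc n) ^ q"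
  let ?V = "\<lambda>n. zeta_val p * ?X m n - zeta_val m * ?Y n"
  let ?S = "\<lambda>r. zeta_star [q + 1, r] + zeta_star [r + q, 1] + zeta_star [r + 1, q]"
  let ?E = "\<lambda>r N. (\<Sum>n<N. zeta_n (Suc n) r / real (Suc n) ^ (q + 1)) +
     (\<Sum>n<N. zeta_n (Suc n) 1 / real (Suc n) ^ (r + q)) +
     (\<Sum>n<N. zeta_n (Suc n) q / real (Suc n) ^ (r + 1)) - zeta_n N (r + q + 1)"
  let ?B = "\<lambda>N. harm N * zeta_n N q * (zeta_val m * zeta_n N p - zeta_val p * zeta_n N m)"

  show U: "summable ?U"
    using assms by (rule summable_cross_product)
  have E: "?E r \<longlonglongrightarrow> ?S r - zeta_val (r + q + 1)" if "r > 1" for r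
    using that assms(3)
    by (intro tendsto_intros zeta_n_tendsto zeta_star_pair_sums [unfolded sums_def]) auto

  \<comment> \<open>Only the weighted difference \<open>?V\<close> is passed to the limit, so that q
    = 1 is covered. Every term on the right converges, which yields the summability of
    \<open>?V\<close> together with its sum.\<close>
  have "(\<Sum>n<N. ?V n) = (\<Sum>n<N. ?U n) - ?B N - zeta_val m * ?E p N + zeta_val p * ?E m N" for N
  proof -
    have by_parts: "(\<Sum>n<N. ?X r n) = harm N * zeta_n N r * zeta_n N q
        - (\<Sum>n<N. zeta_n (Suc n) r * zeta_n (Suc n) q / real (Suc n)) + ?E r N" for r
      using harm_zeta_n_product_by_parts [of N r q] by linarith
    have "(\<Sum>n<N. ?U n) =
        zeta_val m * (\<Sum>n<N. zeta_n (Suc n) p * zeta_n (Suc n) q / real (Suc n)) -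
        zeta_val p * (\<Sum>n<N. zeta_n (Suc n) m * zeta_n (Suc n) q / real (Suc n))"
      by (simp add: sum_distrib_left sum_subtractf [symmetric] diff_divide_distrib mult.assoc
          del: of_nat_Suc)
    moreover have "(\<Sum>n<N. ?V n) = zeta_val p * (\<Sum>n<N. ?X m n) - zeta_val m * (\<Sum>n<N. ?X p n)"
      unfolding sum_distrib_left sum_subtractf [symmetric] by (simp only: add.commute)
    ultimately show ?thesis
      unfolding by_parts by (simp only: algebra_simps)
  qed
  moreover have "(\<lambda>N. (\<Sum>n<N. ?U n) - ?B N - zeta_val m * ?E p N + zeta_val p * ?E m N) \<longlonglongrightarrow>
      suminf ?U - 0 - zeta_val m * (?S p - zeta_val (p + q + 1))
        + zeta_val p * (?S m - zeta_val (m + q + 1))"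
    using assms by (intro tendsto_add tendsto_diff tendsto_mult tendsto_const summable_LIMSEQ [OF U]
        boundary_tendsto_0 E)
  ultimately have V: "?V sums (suminf ?U - 0 - zeta_val m * (?S p - zeta_val (p + q + 1))
        + zeta_val p * (?S m - zeta_val (m + q + 1)))"
    unfolding sums_def by presburger
  show "summable ?V"
    using V by (rule sums_summable)
  show main: "suminf ?U = suminf ?V - zeta_val p * ?S m + zeta_val m * ?S p
      + zeta_val (m + q + 1) * zeta_val p - zeta_val (p + q + 1) * zeta_val m"
    unfolding sums_unique [OF V, symmetric] by (simp only: algebra_simps)

  assume "q > 1"
  show X: "summable (?X m)" and Y: "summable ?Y"
    using assms \<open>q > 1\<close> by (intro summable_add summable_harm_zeta_n_over_power; simp)+
  \<comment> \<open>For q > 1 both series converge, so the combined sum may be split.\<close>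
  have "suminf ?V = zeta_val p * suminf (?X m) - zeta_val m * suminf ?Y"
    using X Y by (simp only: suminf_diff [symmetric] suminf_mult [symmetric] summable_mult)
  thus "suminf ?U = zeta_val p * (suminf (?X m)
        - zeta_star [q + 1, m] - zeta_star [m + q, 1] - zeta_star [m + 1, q])
      - zeta_val m * (suminf ?Y
        - zeta_star [q + 1, p] - zeta_star [p + q, 1] - zeta_star [p + 1, q])
      + zeta_val (m + q + 1) * zeta_val p - zeta_val (p + q + 1) * zeta_val m"
    unfolding main by (simp only: algebra_simps)
qed

end
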